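(* For $n\in\mathbb{N}$ consider the indefinite integrals of the real variable $x$ $$S_n(x)=\int x^n\sin x\,dx,\qquad C_n(x)=\int x^n\cos x\,dx,\qquad E_n(x)=\int x^n e^x\,dx .$$ Then for every $n\in\mathbb{N}$ they can respectively be written in the form $$S_n(x)=s_n(x)\cos x+\hat{s}_{n-1}(x)\sin x+\alpha_n,$$ $$C_n(x)=c_n(x)\sin x+\hat{c}_{n-1}(x)\cos x+\beta_n,$$ $$E_n(x)=e_n(x)\,e^x+\gamma_n,$$ where $s_n$, $c_n$, $e_n$ are polynomials of degree $n$ (for $n\in\mathbb{N}$), $\hat{s}_{n-1}$ and $\hat{c}_{n-1}$ are polynomials of degree $n-1$ (for $n\in\mathbb{N}^\star$), and $\alpha_n,\beta_n,\gamma_n$ are integration constants.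
   Context: $\mathbb{N}=\{0,1,2,\dots\}$ and $\mathbb{N}^\star=\mathbb{N}\setminus\{0\}$. An indefinite integral $\int f(x)\,dx$ denotes an arbitrary antiderivative of $f$. By convention all polynomials with negative index are zero: $s_{-n}=\hat{s}_{-n}=c_{-n}=\hat{c}_{-n}=e_{-n}=0$ for all $n\in\mathbb{N}^\star$ (in particular $\hat{s}_{-1}=\hat{c}_{-1}=0$). *)

theory Defs
  imports Complex_Main "HOL-Computational_Algebra.Polynomial"
begin

definition antiderivative :: "(real \<Rightarrow> real) \<Rightarrow> (real \<Rightarrow> real) \<Rightarrow> bool" where
  "antiderivative F f \<longleftrightarrow> (\<forall>x. (F has_real_derivative f x) (at x))"

(* The library sets degree 0 = 0, so the zero polynomial has to be excluded explicitly:
   it does not count as a polynomial of degree 0. *)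
definition has_degree :: "real poly \<Rightarrow> nat \<Rightarrow> bool" where
  "has_degree p d \<longleftrightarrow> p \<noteq> 0 \<and> degree p = d"

end

theory Submission
  imports Defs
begin

text \<open>
  If \<open>r + r'' = x^n\<close> then \<open>- r cos x + r' sin x\<close> and \<open>r sin x + r' cos x\<close> are antiderivatives of
  \<open>x^n sin x\<close> and \<open>x^n cos x\<close>; if \<open>r + r' = x^n\<close> then \<open>r e^x\<close> is one of \<open>x^n e^x\<close>. Both equations
  have a polynomial solution of degree \<open>n\<close>, since \<open>p \<mapsto> p + D p\<close> is invertible on polynomials
  whenever \<open>D\<close> lowers the degree.
\<close>

text \<open>Strong induction on the degree: if \<open>t\<close> solves \<open>t + D t = D p\<close>,
  then \<open>r = p - t\<close> works, because \<open>D r = D p - D t = t\<close>. Since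
  \<open>t\<close> has the degree of \<open>D p\<close>, which is below that of \<open>p\<close>,
  subtracting it leaves the leading term of \<open>p\<close> intact.\<close>

lemma degree_lowering_resolvent:
  fixes D :: "'a::comm_ring_1 poly \<Rightarrow> 'a poly"
  assumes diff: "\<And>p q. D (p - q) = D p - D q"
    and lower: "\<And>p. D p \<noteq> 0 \<Longrightarrow> degree (D p) < degree p"
    and "p \<noteq> 0"
  shows "\<exists>r. r \<noteq> 0 \<and> degree r = degree p \<and> r + D r = p"
  using \<open>p \<noteq> 0\<close>
proof (induction "degree p" arbitrary: p rule: less_induct)
  case less
  show ?case
  proof (cases "D p = 0")
    case True
    then show ?thesis using less.prems by auto
  next
    case False
    note lt = lower[OF False]
    obtain t where t: "degree t = degree (D p)" "t + D t = D p"
      using less.hyps[OF lt False] by blast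
    have "degree (p - t) = degree p"
      using degree_add_eq_left[of "- t" p] lt t(1) by simp
    moreover have "p - t \<noteq> 0"
      using lt t(1) by auto
    moreover have "(p - t) + D (p - t) = p"
      using t(2) by (simp add: diff algebra_simps)
    ultimately show ?thesis by blast
  qed
qed

lemma degree_pderiv_less:
  fixes p :: "'a::{comm_semiring_1,semiring_no_zero_divisors,semiring_char_0} poly"
  assumes "pderiv p \<noteq> 0"
  shows "degree (pderiv p) < degree p"
  using assms by (metis degree_pderiv pderiv_eq_0_iff diff_less gr0I zero_less_one)

lemma ex_add_pderiv_eq_monom:
  "\<exists>r::real poly. has_degree r n \<and> r + pderiv r = monom 1 n"
  using degree_lowering_resolvent[of pderiv "monom (1::real) n"]
  by (auto simp: has_degree_def pderiv_diff degree_pderiv_less degree_monom_eq)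

lemma ex_add_pderiv2_eq_monom:
  "\<exists>r::real poly. has_degree r n \<and> r + pderiv (pderiv r) = monom 1 n"
proof -
  have "degree (pderiv (pderiv p)) < degree p" if "pderiv (pderiv p) \<noteq> 0" for p :: "real poly"
  proof -
    have "pderiv p \<noteq> 0"
      using that by auto
    then show ?thesis
      using degree_pderiv_less that less_trans by blast
  qed
  then show ?thesis
    using degree_lowering_resolvent[of "\<lambda>p. pderiv (pderiv p)" "monom (1::real) n"]
    by (auto simp: has_degree_def pderiv_diff degree_monom_eq)
qed

lemma has_degree_pderiv:
  assumes "has_degree p n" "n \<ge> 1"
  shows "has_degree (pderiv p) (n - 1)"
  using assms by (auto simp: has_degree_def degree_pderiv pderiv_eq_0_iff)

text \<open>The difference has derivative zero on the whole line. This reduces a claim about every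
  antiderivative to exhibiting a single one.\<close>

lemma antiderivative_unique:
  assumes "antiderivative F f" "antiderivative G f"
  shows "\<exists>c. \<forall>x. F x = G x + c"
proof -
  have "((\<lambda>x. F x - G x) has_real_derivative 0) (at x)" for x
    using assms DERIV_diff[of F "f x" x UNIV G "f x"] by (simp add: antiderivative_def)
  then have "F x - G x = F 0 - G 0" for x
    using DERIV_isconst_all[of "\<lambda>x. F x - G x"] by blast
  then show ?thesis
    by (metis add.commute diff_add_cancel)
qed

text \<open>In the product rule the two terms \<open>r' cos x\<close> cancel, leaving
  \<open>(r + r'') sin x\<close>.\<close>

lemma antiderivative_sin:
  assumes "r + pderiv (pderiv r) = p"
  shows "antiderivative (\<lambda>x. poly (- r) x * cos x + poly (pderiv r) x * sin x)
    (\<lambda>x. poly p x * sin x)"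
  unfolding antiderivative_def assms[symmetric]
  by (auto intro!: derivative_eq_intros simp: algebra_simps)

text \<open>Here the terms \<open>r' sin x\<close> cancel, leaving
  \<open>(r + r'') cos x\<close>.\<close>

lemma antiderivative_cos:
  assumes "r + pderiv (pderiv r) = p"
  shows "antiderivative (\<lambda>x. poly r x * sin x + poly (pderiv r) x * cos x)
    (\<lambda>x. poly p x * cos x)"
  unfolding antiderivative_def assms[symmetric]
  by (auto intro!: derivative_eq_intros simp: algebra_simps)

lemma antiderivative_exp:
  assumes "r + pderiv r = p"
  shows "antiderivative (\<lambda>x. poly r x * exp x) (\<lambda>x. poly p x * exp x)"
  unfolding antiderivative_def assms[symmetric]
  by (auto intro!: derivative_eq_intros simp: algebra_simps)

theorem theorem1:
  shows "\<exists>s s_hat c c_hat e :: int \<Rightarrow> real poly.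
    (\<forall>k<0. s k = 0 \<and> s_hat k = 0 \<and> c k = 0 \<and> c_hat k = 0 \<and> e k = 0) \<and>
    (\<forall>n::nat. has_degree (s (int n)) n \<and> has_degree (c (int n)) n \<and> has_degree (e (int n)) n) \<and>
    (\<forall>n::nat. n \<ge> 1 \<longrightarrow>
       has_degree (s_hat (int n - 1)) (n - 1) \<and> has_degree (c_hat (int n - 1)) (n - 1)) \<and>
    (\<forall>n::nat.
       (\<forall>S. antiderivative S (\<lambda>x. x ^ n * sin x) \<longrightarrow>
          (\<exists>\<alpha>::real. \<forall>x. S x =
             poly (s (int n)) x * cos x + poly (s_hat (int n - 1)) x * sin x + \<alpha>)) \<and>
       (\<forall>C. antiderivative C (\<lambda>x. x ^ n * cos x) \<longrightarrow>
          (\<exists>\<beta>::real. \<forall>x. C x =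
             poly (c (int n)) x * sin x + poly (c_hat (int n - 1)) x * cos x + \<beta>)) \<and>
       (\<forall>E. antiderivative E (\<lambda>x. x ^ n * exp x) \<longrightarrow>
          (\<exists>\<gamma>::real. \<forall>x. E x = poly (e (int n)) x * exp x + \<gamma>)))"
proof -
  \<comment> \<open>One family \<open>R\<close> serves both the sine and the cosine
    integrals.\<close>
  obtain R :: "nat \<Rightarrow> real poly" where
    R: "\<And>n. has_degree (R n) n" "\<And>n. R n + pderiv (pderiv (R n)) = monom 1 n"
    using ex_add_pderiv2_eq_monom by metis
  obtain Q :: "nat \<Rightarrow> real poly" where
    Q: "\<And>n. has_degree (Q n) n" "\<And>n. Q n + pderiv (Q n) = monom 1 n"
    using ex_add_pderiv_eq_monom by metis
  \<comment> \<open>Extension by zero to negative indices, as the convention demands.\<close>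
  define ext :: "(nat \<Rightarrow> real poly) \<Rightarrow> int \<Rightarrow> real poly"
    where "ext f k = (if k < 0 then 0 else f (nat k))" for f k
  \<comment> \<open>The shift by \<open>Suc\<close> places \<open>pderiv (R n)\<close> at index
    \<open>n - 1\<close>, matching its degree when \<open>n \<ge> 1\<close>.\<close>
  define hat where "hat = ext (\<lambda>n. pderiv (R (Suc n)))"
  have ext_neg: "ext f k = 0" if "k < 0" for f k
    using that by (simp add: ext_def)
  have ext_int: "ext f (int n) = f n" for f n
    by (simp add: ext_def)
  have hat: "hat (int n - 1) = pderiv (R n)" for n
  proof (cases n)
    \<comment> \<open>At index \<open>-1\<close> the value is the default 0; this agrees with
      \<open>pderiv (R 0)\<close> because \<open>R 0\<close> is constant.\<close>
    case 0
    then show ?thesis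
      using R(1)[of 0] by (simp add: hat_def ext_def has_degree_def pderiv_eq_0_iff)
  next
    case (Suc m)
    then show ?thesis
      by (simp add: hat_def ext_def)
  qed
  have hat_neg: "hat k = 0" if "k < 0" for k
    using that by (simp add: hat_def ext_neg)
  have "\<exists>\<alpha>. \<forall>x. S x = poly (- R n) x * cos x + poly (pderiv (R n)) x * sin x + \<alpha>"
    if "antiderivative S (\<lambda>x. x ^ n * sin x)" for n S
    using antiderivative_unique[OF that] antiderivative_sin[OF R(2)[of n]]
    by (simp add: poly_monom)
  moreover have "\<exists>\<beta>. \<forall>x. C x = poly (R n) x * sin x + poly (pderiv (R n)) x * cos x + \<beta>"
    if "antiderivative C (\<lambda>x. x ^ n * cos x)" for n C
    using antiderivative_unique[OF that] antiderivative_cos[OF R(2)[of n]]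
    by (simp add: poly_monom)
  moreover have "\<exists>\<gamma>. \<forall>x. E x = poly (Q n) x * exp x + \<gamma>"
    if "antiderivative E (\<lambda>x. x ^ n * exp x)" for n E
    using antiderivative_unique[OF that] antiderivative_exp[OF Q(2)[of n]]
    by (simp add: poly_monom)
  moreover have "has_degree (- R n) n" for n
    using R(1)[of n] by (simp add: has_degree_def)
  ultimately show ?thesis
    \<comment> \<open>Witnesses: \<open>s = -R\<close>, \<open>c = R\<close>, \<open>e = Q\<close>,
      and the same \<open>hat\<close> for both \<open>s_hat\<close> and
      \<open>c_hat\<close>.\<close>
    using R(1) Q(1) has_degree_pderiv[OF R(1)]
    by - (rule exI[of _ "ext (\<lambda>n. - R n)"], rule exI[of _ hat], rule exI[of _ "ext R"],
      rule exI[of _ hat], rule exI[of _ "ext Q"], simp add: ext_int hat ext_neg hat_neg)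
qed

end
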